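(* Let $\Gamma\cup\{\phi\}$ be a set of $\mathcal{ML}(\subseteq)$-formulas. If $\Gamma\vdash\phi$, then $\Gamma\models\phi$, where $\vdash$ is derivability in the natural deduction system for modal inclusion logic $\mathcal{ML}(\subseteq)$.
   Context: SYNTAX. Fix a countably infinite set $\mathsf{Prop}$ of propositional symbols. Classical formulas ($\mathcal{ML}$): $\alpha::=p\mid\bot\mid\neg\alpha\mid(\alpha\lor\alpha)\mid(\alpha\land\alpha)\mid\Diamond\alpha\mid\Box\alpha$; $\top:=\neg\bot$. Letters $\alpha,\beta$ (with indices) always denote classical formulas. $\mathcal{ML}(\subseteq)$: $\phi::=p\mid\bot\mid(\alpha_1\dots\alpha_n\subseteq\beta_1\dots\beta_n)\mid\neg\alpha\mid(\phi\lor\phi)\mid(\phi\land\phi)\mid\Diamond\phi\mid\Box\phi$. Sans-serif $\mathsf{a},\mathsf{b},\mathsf{c}$ denote finite sequences of classical formulas ($|\mathsf{a}|$ is the length), the two sides of an inclusion atom always having the same length; $\mathsf{x}$ denotes a sequence of elements of $\{\top,\bot\}$, and $x$ an element of $\{\top,\bot\}$. $\alpha^\top:=\alpha$, $\alpha^\bot:=\neg\alpha$, and $\mathsf{a}^\mathsf{x}:=\alpha_1^{x_1}\land\dots\land\alpha_n^{x_n}$. SEMANTICS. A Kripke model is $M=(W,R,V)$ with $R\subseteq W\times W$ and $V$ assigning a subset of $W$ to each relevant propositional symbol; a team is a set $T\subseteq W$. $R[T]=\{v\mid\exists w\in T:wRv\}$, $R^{-1}[T]=\{w\mid\exists v\in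 T:wRv\}$; $TRS$ means $S\subseteq R[T]$ and $T\subseteq R^{-1}[S]$. $M,T\models p$ iff $T\subseteq V(p)$; $\models\bot$ iff $T=\emptyset$; $M,T\models\alpha_1\dots\alpha_n\subseteq\beta_1\dots\beta_n$ iff for all $w\in T$ there is $v\in T$ such that for all $i$, $M,\{w\}\models\alpha_i$ iff $M,\{v\}\models\beta_i$; $M,T\models\neg\alpha$ iff $M,\{w\}\not\models\alpha$ for all $w\in T$; $M,T\models\phi\lor\psi$ iff $T=T_1\cup T_2$ for some $T_1,T_2$ with $M,T_1\models\phi$, $M,T_2\models\psi$; $M,T\models\phi\land\psi$ iff both hold at $M,T$; $M,T\models\Diamond\phi$ iff $M,S\models\phi$ for some $S$ with $TRS$; $M,T\models\Box\phi$ iff $M,R[T]\models\phi$. $\Gamma\models\phi$ means: for all models $M$ and teams $T$ of $M$, if $M,T\models\gamma$ for all $\gamma\in\Gamma$ then $M,T\models\phi$. PROOF SYSTEM. $\Gamma\vdash\phi$ means that $\phi$ has a natural deduction derivation whose undischarged assumptions all lie in $\Gamma$. Equivalently, $\vdash$ is the least relation such that $\Gamma\vdash\phi$ whenever $\phi\in\Gamma$, and closed under the following rules. "$\phi_1,\dots,\phi_n\,/\,\psi$" means: if $\Gamma\vdash\phi_i$ for all $i$, then $\Gamma\vdash\psi$. $\Delta$ always denotes a set of classical formulas with $\Delta\subseteq\Gamma$. Classical rules: ($\neg$I) if $\Delta\cup\{\alpha\}\vdash\bot$ then $\Gamma\vdash\neg\alpha$. (RAA) if $\Delta\cup\{\neg\alpha\}\vdash\bot$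 then $\Gamma\vdash\alpha$. ($\neg$E) $\alpha,\neg\alpha\,/\,\phi$. ($\lor$I) $\phi\,/\,\phi\lor\psi$ and $\psi\,/\,\phi\lor\psi$. ($\lor$E) if $\Gamma\vdash\phi\lor\psi$, $\Delta\cup\{\phi\}\vdash\chi$ and $\Delta\cup\{\psi\}\vdash\chi$ then $\Gamma\vdash\chi$. ($\land$I) $\phi,\psi\,/\,\phi\land\psi$. ($\land$E) $\phi\land\psi\,/\,\phi$ and $\phi\land\psi\,/\,\psi$. ($\Diamond\Box$Inter) $\neg\Box\alpha\,/\,\Diamond\neg\alpha$. ($\Box\Diamond$Inter) $\Diamond\neg\alpha\,/\,\neg\Box\alpha$. ($\Diamond\lor$Distr) $\Diamond(\phi\lor\psi)\,/\,\Diamond\phi\lor\Diamond\psi$. ($\Box$Mon) if $\{\phi_1,\dots,\phi_n\}\vdash\psi$ and $\Gamma\vdash\Box\phi_i$ for $i=1,\dots,n$ then $\Gamma\vdash\Box\psi$ ($n\ge 0$). ($\Diamond$Mon) if $\{\phi\}\vdash\psi$ and $\Gamma\vdash\Diamond\phi$ then $\Gamma\vdash\Diamond\psi$. Inclusion rules: ($\subseteq$Id) $/\ \mathsf{a}\subseteq\mathsf{a}$. ($\subseteq$Exp) $\alpha^x,\ \mathsf{b}\subseteq\mathsf{c}\,/\,x\mathsf{b}\subseteq\alpha\mathsf{c}$. ($\subseteq_\neg$E) $\neg\mathsf{a}^\mathsf{x},\ \mathsf{x}\subseteq\mathsf{a}\,/\,\phi$. ($\lor_\subseteq$E) if $\Gamma\vdash\mathsf{x}\subseteq\mathsf{a}\lor\psi$,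 $\Gamma\cup\{\mathsf{x}\subseteq\mathsf{a}\}\vdash\chi$ and $\Gamma\cup\{\psi\}\vdash\chi$ then $\Gamma\vdash\chi$. ($\subseteq$Ext) $\bigwedge_{\mathsf{x}\in\{\top,\bot\}^{|\mathsf{a}|}}(\neg\mathsf{a}^\mathsf{x}\lor\mathsf{x}\subseteq\mathsf{b})\,/\,\mathsf{a}\subseteq\mathsf{b}$. ($\subseteq$Rdt) $\mathsf{a}\subseteq\mathsf{b}\,/\,\neg\mathsf{a}^\mathsf{x}\lor\mathsf{x}\subseteq\mathsf{b}$. ($\subseteq$Distr) $\phi\lor\psi,\ \mathsf{x}_1\subseteq\mathsf{a}_1,\dots,\mathsf{x}_n\subseteq\mathsf{a}_n\,/\,((\phi\lor\mathsf{a}_1^{\mathsf{x}_1}\lor\dots\lor\mathsf{a}_n^{\mathsf{x}_n})\land\mathsf{x}_1\subseteq\mathsf{a}_1\land\dots\land\mathsf{x}_n\subseteq\mathsf{a}_n)\lor\psi$. Modal inclusion rules: ($\Diamond_\subseteq$Distr) $\Diamond(\mathsf{x}\subseteq\mathsf{a})\,/\,\top\subseteq\Diamond\mathsf{a}^\mathsf{x}$. ($\Diamond\Box_\subseteq$Exc) $\top\subseteq\Diamond\mathsf{a}^\mathsf{x}\,/\,\Box(\mathsf{x}\subseteq\mathsf{a})$. ($\Box\Diamond_\subseteq$Exc) $\top\subseteq\Diamond\beta,\ \Box(\mathsf{x}\subseteq\mathsf{a})\,/\,\top\subseteq\Diamond\mathsf{a}^\mathsf{x}$. ($\Box\lor_\subseteq$E)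 if $\Gamma\vdash\Box(\mathsf{x}\subseteq\mathsf{a}\lor\psi)$, $\Gamma\cup\{\top\subseteq\Diamond\mathsf{a}^\mathsf{x}\}\vdash\chi$ and $\Gamma\cup\{\Box\psi\}\vdash\chi$ then $\Gamma\vdash\chi$. ($\subseteq_\Diamond$Distr) $\Diamond\phi,\ x_1\subseteq\Diamond\alpha_1,\dots,x_n\subseteq\Diamond\alpha_n\,/\,\Diamond((\phi\lor\alpha_1^{x_1}\lor\dots\lor\alpha_n^{x_n})\land x_1\subseteq\alpha_1\land\dots\land x_n\subseteq\alpha_n)$. *)

theory Defs
  imports Main "HOL-Library.Countable" "HOL-Library.Infinite_Typeclass"
begin

section \<open>Syntax\<close>

datatype 'p ml =
    CAtom 'p
  | CBot
  | CNeg "'p ml"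
  | COr "'p ml" "'p ml"
  | CAnd "'p ml" "'p ml"
  | CDia "'p ml"
  | CBox "'p ml"

text \<open>An inclusion atom is the list of its pairs \<open>(\<alpha>\<^sub>i, \<beta>\<^sub>i)\<close>, so both sides have the same
  length by construction. The empty atom is allowed.\<close>

datatype 'p mlinc =
    Atom 'p
  | Bot
  | Inc "('p ml \<times> 'p ml) list"
  | Neg "'p ml"
  | Or "'p mlinc" "'p mlinc"
  | And "'p mlinc" "'p mlinc"
  | Dia "'p mlinc"
  | Box "'p mlinc"

primrec emb :: "'p ml \<Rightarrow> 'p mlinc" where
  "emb (CAtom p) = Atom p"
| "emb CBot = Bot"
| "emb (CNeg \<alpha>) = Neg \<alpha>"
| "emb (COr \<alpha> \<beta>) = Or (emb \<alpha>) (emb \<beta>)"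
| "emb (CAnd \<alpha> \<beta>) = And (emb \<alpha>) (emb \<beta>)"
| "emb (CDia \<alpha>) = Dia (emb \<alpha>)"
| "emb (CBox \<alpha>) = Box (emb \<alpha>)"

abbreviation classical :: "'p mlinc set \<Rightarrow> bool" where
  "classical \<Delta> \<equiv> \<Delta> \<subseteq> range emb"

text \<open>Iterated conjunctions and disjunctions are bracketed to the right; the neutral element \<open>e\<close>
  is only used for the empty list.\<close>

fun iter :: "('a \<Rightarrow> 'a \<Rightarrow> 'a) \<Rightarrow> 'a \<Rightarrow> 'a list \<Rightarrow> 'a" where
  "iter f e [] = e"
| "iter f e [x] = x"
| "iter f e (x # y # zs) = f x (iter f e (y # zs))"

abbreviation CTop :: "'p ml" where
  "CTop \<equiv> CNeg CBot"

abbreviation Top :: "'p mlinc" where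
  "Top \<equiv> Neg CBot"

abbreviation big_cand :: "'p ml list \<Rightarrow> 'p ml" where
  "big_cand \<equiv> iter CAnd CTop"

abbreviation big_and :: "'p mlinc list \<Rightarrow> 'p mlinc" where
  "big_and \<equiv> iter And Top"

abbreviation big_or :: "'p mlinc list \<Rightarrow> 'p mlinc" where
  "big_or \<equiv> iter Or Bot"

text \<open>Elements \<open>x\<close> of \<open>{\<top>, \<bottom>}\<close> are represented by Booleans; \<open>tv\<close> is the formula denoted by \<open>x\<close>,
  \<open>pow \<alpha> x\<close> is \<open>\<alpha>\<^sup>x\<close>, and \<open>pows as xs\<close> is its extension to sequences of equal length.\<close>

definition tv :: "bool \<Rightarrow> 'p ml" where
  "tv x = (if x then CTop else CBot)"

definition pow :: "'p ml \<Rightarrow> bool \<Rightarrow> 'p ml" where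
  "pow \<alpha> x = (if x then \<alpha> else CNeg \<alpha>)"

definition pows :: "'p ml list \<Rightarrow> bool list \<Rightarrow> 'p ml" where
  "pows as xs = big_cand (map2 pow as xs)"

text \<open>Only meaningful for lists of equal length, since \<open>zip\<close> truncates; every rule below that uses
  \<open>incl\<close> or \<open>pows\<close> requires this.\<close>

definition incl :: "'p ml list \<Rightarrow> 'p ml list \<Rightarrow> 'p mlinc" where
  "incl as bs = Inc (zip as bs)"

abbreviation tincl :: "bool list \<Rightarrow> 'p ml list \<Rightarrow> 'p mlinc" where
  "tincl xs as \<equiv> incl (map tv xs) as"


section \<open>Team semantics\<close>

record ('w, 'p) kripke =
  worlds :: "'w set"
  rel :: "('w \<times> 'w) set"
  val :: "'p \<Rightarrow> 'w set"

definition kripke_model :: "('w, 'p) kripke \<Rightarrow> bool" where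
  "kripke_model M \<longleftrightarrow> rel M \<subseteq> worlds M \<times> worlds M \<and> (\<forall>p. val M p \<subseteq> worlds M)"

definition team_succ :: "('w, 'p) kripke \<Rightarrow> 'w set \<Rightarrow> 'w set \<Rightarrow> bool" where
  "team_succ M T S \<longleftrightarrow> S \<subseteq> rel M `` T \<and> T \<subseteq> (rel M)\<inverse> `` S"

lemma size_emb: "size (emb \<alpha>) = size \<alpha>"
  by (induction \<alpha>) auto

lemma size_Inc:
  assumes "(\<alpha>, \<beta>) \<in> set ps"
  shows "size \<alpha> < size (Inc ps)" "size \<beta> < size (Inc ps)"
  using size_list_estimation'[OF assms, of "size \<alpha>" "size_prod size size"]
    size_list_estimation'[OF assms, of "size \<beta>" "size_prod size size"] by auto

function sat :: "('w, 'p) kripke \<Rightarrow> 'w set \<Rightarrow> 'p mlinc \<Rightarrow> bool" where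
  "sat M T (Atom p) \<longleftrightarrow> T \<subseteq> val M p"
| "sat M T Bot \<longleftrightarrow> T = {}"
| "sat M T (Inc ps) \<longleftrightarrow>
     (\<forall>w\<in>T. \<exists>v\<in>T. \<forall>q\<in>set ps. sat M {w} (emb (fst q)) \<longleftrightarrow> sat M {v} (emb (snd q)))"
| "sat M T (Neg \<alpha>) \<longleftrightarrow> (\<forall>w\<in>T. \<not> sat M {w} (emb \<alpha>))"
| "sat M T (Or \<phi> \<psi>) \<longleftrightarrow> (\<exists>T1 T2. T = T1 \<union> T2 \<and> sat M T1 \<phi> \<and> sat M T2 \<psi>)"
| "sat M T (And \<phi> \<psi>) \<longleftrightarrow> sat M T \<phi> \<and> sat M T \<psi>"
| "sat M T (Dia \<phi>) \<longleftrightarrow> (\<exists>S. team_succ M T S \<and> sat M S \<phi>)"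
| "sat M T (Box \<phi>) \<longleftrightarrow> sat M (rel M `` T) \<phi>"
  by pat_completeness auto
termination
  by (relation "Wellfounded.measure (\<lambda>(M, T, \<phi>). size \<phi>)")
    (auto simp: size_emb dest: size_Inc)

text \<open>The first argument only fixes the type of worlds, over which a definition in HOL cannot
  quantify.\<close>

definition entails :: "'w itself \<Rightarrow> 'p mlinc set \<Rightarrow> 'p mlinc \<Rightarrow> bool" where
  "entails _ \<Gamma> \<phi> \<longleftrightarrow> (\<forall>(M :: ('w, 'p) kripke) T. kripke_model M \<longrightarrow> T \<subseteq> worlds M \<longrightarrow>
     (\<forall>\<gamma>\<in>\<Gamma>. sat M T \<gamma>) \<longrightarrow> sat M T \<phi>)"


section \<open>Natural deduction\<close>

inductive derives :: "'p mlinc set \<Rightarrow> 'p mlinc \<Rightarrow> bool" (infix \<open>\<turnstile>\<close> 50) where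
  Assm: "\<phi> \<in> \<Gamma> \<Longrightarrow> \<Gamma> \<turnstile> \<phi>"

| NegI: "\<lbrakk>classical \<Delta>; \<Delta> \<subseteq> \<Gamma>; \<Delta> \<union> {emb \<alpha>} \<turnstile> Bot\<rbrakk> \<Longrightarrow> \<Gamma> \<turnstile> Neg \<alpha>"
| RAA: "\<lbrakk>classical \<Delta>; \<Delta> \<subseteq> \<Gamma>; \<Delta> \<union> {Neg \<alpha>} \<turnstile> Bot\<rbrakk> \<Longrightarrow> \<Gamma> \<turnstile> emb \<alpha>"
| NegE: "\<lbrakk>\<Gamma> \<turnstile> emb \<alpha>; \<Gamma> \<turnstile> Neg \<alpha>\<rbrakk> \<Longrightarrow> \<Gamma> \<turnstile> \<phi>"
| OrI1: "\<Gamma> \<turnstile> \<phi> \<Longrightarrow> \<Gamma> \<turnstile> Or \<phi> \<psi>"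
| OrI2: "\<Gamma> \<turnstile> \<psi> \<Longrightarrow> \<Gamma> \<turnstile> Or \<phi> \<psi>"
| OrE: "\<lbrakk>classical \<Delta>; \<Delta> \<subseteq> \<Gamma>; \<Gamma> \<turnstile> Or \<phi> \<psi>; \<Delta> \<union> {\<phi>} \<turnstile> \<chi>; \<Delta> \<union> {\<psi>} \<turnstile> \<chi>\<rbrakk> \<Longrightarrow> \<Gamma> \<turnstile> \<chi>"
| AndI: "\<lbrakk>\<Gamma> \<turnstile> \<phi>; \<Gamma> \<turnstile> \<psi>\<rbrakk> \<Longrightarrow> \<Gamma> \<turnstile> And \<phi> \<psi>"
| AndE1: "\<Gamma> \<turnstile> And \<phi> \<psi> \<Longrightarrow> \<Gamma> \<turnstile> \<phi>"
| AndE2: "\<Gamma> \<turnstile> And \<phi> \<psi> \<Longrightarrow> \<Gamma> \<turnstile> \<psi>"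
| DiaBoxInter: "\<Gamma> \<turnstile> Neg (CBox \<alpha>) \<Longrightarrow> \<Gamma> \<turnstile> Dia (Neg \<alpha>)"
| BoxDiaInter: "\<Gamma> \<turnstile> Dia (Neg \<alpha>) \<Longrightarrow> \<Gamma> \<turnstile> Neg (CBox \<alpha>)"
| DiaOrDistr: "\<Gamma> \<turnstile> Dia (Or \<phi> \<psi>) \<Longrightarrow> \<Gamma> \<turnstile> Or (Dia \<phi>) (Dia \<psi>)"
| BoxMon: "\<lbrakk>set \<phi>s \<turnstile> \<psi>; \<And>\<phi>. \<phi> \<in> set \<phi>s \<Longrightarrow> \<Gamma> \<turnstile> Box \<phi>\<rbrakk> \<Longrightarrow> \<Gamma> \<turnstile> Box \<psi>"
| DiaMon: "\<lbrakk>{\<phi>} \<turnstile> \<psi>; \<Gamma> \<turnstile> Dia \<phi>\<rbrakk> \<Longrightarrow> \<Gamma> \<turnstile> Dia \<psi>"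

| IncId: "\<Gamma> \<turnstile> incl as as"
| IncExp: "\<lbrakk>length bs = length cs; \<Gamma> \<turnstile> emb (pow \<alpha> x); \<Gamma> \<turnstile> incl bs cs\<rbrakk> \<Longrightarrow>
    \<Gamma> \<turnstile> incl (tv x # bs) (\<alpha> # cs)"
| IncNegE: "\<lbrakk>length xs = length as; \<Gamma> \<turnstile> Neg (pows as xs); \<Gamma> \<turnstile> tincl xs as\<rbrakk> \<Longrightarrow> \<Gamma> \<turnstile> \<phi>"
| OrIncE: "\<lbrakk>length xs = length as; \<Gamma> \<turnstile> Or (tincl xs as) \<psi>;
    \<Gamma> \<union> {tincl xs as} \<turnstile> \<chi>; \<Gamma> \<union> {\<psi>} \<turnstile> \<chi>\<rbrakk> \<Longrightarrow> \<Gamma> \<turnstile> \<chi>"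
| IncExt: "\<lbrakk>length as = length bs;
    \<Gamma> \<turnstile> big_and (map (\<lambda>xs. Or (Neg (pows as xs)) (tincl xs bs))
          (List.n_lists (length as) [True, False]))\<rbrakk> \<Longrightarrow> \<Gamma> \<turnstile> incl as bs"
| IncRdt: "\<lbrakk>length as = length bs; length xs = length as; \<Gamma> \<turnstile> incl as bs\<rbrakk> \<Longrightarrow>
    \<Gamma> \<turnstile> Or (Neg (pows as xs)) (tincl xs bs)"
| IncDistr: "\<lbrakk>\<Gamma> \<turnstile> Or \<phi> \<psi>;
    \<And>xs as. (xs, as) \<in> set ps \<Longrightarrow> length xs = length as;
    \<And>xs as. (xs, as) \<in> set ps \<Longrightarrow> \<Gamma> \<turnstile> tincl xs as\<rbrakk> \<Longrightarrow>
    \<Gamma> \<turnstile> Or (big_and (big_or (\<phi> # map (\<lambda>(xs, as). emb (pows as xs)) ps) #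
               map (\<lambda>(xs, as). tincl xs as) ps)) \<psi>"

| DiaIncDistr: "\<lbrakk>length xs = length as; \<Gamma> \<turnstile> Dia (tincl xs as)\<rbrakk> \<Longrightarrow>
    \<Gamma> \<turnstile> incl [CTop] [CDia (pows as xs)]"
| DiaBoxIncExc: "\<lbrakk>length xs = length as; \<Gamma> \<turnstile> incl [CTop] [CDia (pows as xs)]\<rbrakk> \<Longrightarrow>
    \<Gamma> \<turnstile> Box (tincl xs as)"
| BoxDiaIncExc: "\<lbrakk>length xs = length as; \<Gamma> \<turnstile> incl [CTop] [CDia \<beta>]; \<Gamma> \<turnstile> Box (tincl xs as)\<rbrakk> \<Longrightarrow>
    \<Gamma> \<turnstile> incl [CTop] [CDia (pows as xs)]"
| BoxOrIncE: "\<lbrakk>length xs = length as; \<Gamma> \<turnstile> Box (Or (tincl xs as) \<psi>);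
    \<Gamma> \<union> {incl [CTop] [CDia (pows as xs)]} \<turnstile> \<chi>; \<Gamma> \<union> {Box \<psi>} \<turnstile> \<chi>\<rbrakk> \<Longrightarrow> \<Gamma> \<turnstile> \<chi>"
| IncDiaDistr: "\<lbrakk>\<Gamma> \<turnstile> Dia \<phi>;
    \<And>x \<alpha>. (x, \<alpha>) \<in> set ps \<Longrightarrow> \<Gamma> \<turnstile> tincl [x] [CDia \<alpha>]\<rbrakk> \<Longrightarrow>
    \<Gamma> \<turnstile> Dia (big_and (big_or (\<phi> # map (\<lambda>(x, \<alpha>). emb (pow \<alpha> x)) ps) #
                map (\<lambda>(x, \<alpha>). tincl [x] [\<alpha>]) ps))"

end

theory Submission
  imports Defs
begin

text \<open>Soundness is an induction on derivations, for a fixed model and all teams at once (the rules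
  for \<open>\<Diamond>\<close> and \<open>\<box>\<close> move to another team). Three closure properties of team semantics carry it.
  Classical formulas are flat: a team satisfies them iff each of its worlds does, in the ordinary
  Kripke sense (lemma \<open>sat_emb\<close>). So the classical side assumptions \<open>\<Delta>\<close> survive the passage to
  subteams that \<open>NegI\<close>, \<open>RAA\<close> and \<open>OrE\<close> perform. Every formula holds in the empty team
  (\<open>sat_empty\<close>), which is why a contradiction entails every formula. And satisfaction is closed
  under unions (\<open>sat_Un\<close>), which reassembles the two halves of a split team in \<open>OrE\<close>.

  For the inclusion rules, the point is that an atom \<open>\<x> \<subseteq> \<a>\<close> whose left side is constant says
  only that the team is empty or contains a world satisfying \<open>\<a>\<^sup>\<x>\<close> (\<open>sat_tincl\<close>). Such an
  atom passes from a nonempty subteam to any larger team, which yields the two elimination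
  rules for disjunctions with such an atom, although these allow assumptions that are not downward
  closed. The two distribution rules enlarge a team by all
  available witnesses of the given atoms, so that the atoms become true in it; the worlds that were
  added are exactly what the extra classical disjuncts absorb (\<open>sat_big_or_enlarge\<close>).\<close>

section \<open>Flatness, the empty team and unions\<close>

primrec holds :: "('w, 'p) kripke \<Rightarrow> 'w \<Rightarrow> 'p ml \<Rightarrow> bool" where
  "holds M w (CAtom p) \<longleftrightarrow> w \<in> val M p"
| "holds M w CBot \<longleftrightarrow> False"
| "holds M w (CNeg \<alpha>) \<longleftrightarrow> \<not> holds M w \<alpha>"
| "holds M w (COr \<alpha> \<beta>) \<longleftrightarrow> holds M w \<alpha> \<or> holds M w \<beta>"
| "holds M w (CAnd \<alpha> \<beta>) \<longleftrightarrow> holds M w \<alpha> \<and> holds M w \<beta>"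
| "holds M w (CDia \<alpha>) \<longleftrightarrow> (\<exists>v. (w, v) \<in> rel M \<and> holds M v \<alpha>)"
| "holds M w (CBox \<alpha>) \<longleftrightarrow> (\<forall>v. (w, v) \<in> rel M \<longrightarrow> holds M v \<alpha>)"

text \<open>In the cases of \<open>\<or>\<close> and \<open>\<Diamond>\<close> the required subteam or successor team is taken as large as
  possible: all worlds where the subformula holds.\<close>

lemma sat_emb [simp]: "sat M T (emb \<alpha>) \<longleftrightarrow> (\<forall>w\<in>T. holds M w \<alpha>)"
proof (induction \<alpha> arbitrary: T)
  case (COr \<alpha> \<beta>)
  have "\<exists>T1 T2. T = T1 \<union> T2 \<and> (\<forall>w\<in>T1. holds M w \<alpha>) \<and> (\<forall>w\<in>T2. holds M w \<beta>)"
    if "\<forall>w\<in>T. holds M w \<alpha> \<or> holds M w \<beta>"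
    using that by (intro exI[of _ "{w\<in>T. holds M w \<alpha>}"] exI[of _ "{w\<in>T. holds M w \<beta>}"]) auto
  then show ?case using COr by auto
next
  case (CDia \<alpha>)
  have "\<exists>S. team_succ M T S \<and> (\<forall>w\<in>S. holds M w \<alpha>)"
    if "\<forall>w\<in>T. \<exists>v. (w, v) \<in> rel M \<and> holds M v \<alpha>"
    using that
    by (intro exI[of _ "{v \<in> rel M `` T. holds M v \<alpha>}"]) (auto simp: team_succ_def, blast)
  moreover have "\<forall>w\<in>T. \<exists>v. (w, v) \<in> rel M \<and> holds M v \<alpha>"
    if "team_succ M T S" "\<forall>w\<in>S. holds M w \<alpha>" for S
    using that by (fastforce simp: team_succ_def)
  ultimately show ?case using CDia by auto
qed auto

lemma sat_Neg [simp]: "sat M T (Neg \<alpha>) \<longleftrightarrow> (\<forall>w\<in>T. \<not> holds M w \<alpha>)"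
  by simp

lemma sat_Inc [simp]:
  "sat M T (Inc ps) \<longleftrightarrow>
    (\<forall>w\<in>T. \<exists>v\<in>T. \<forall>q\<in>set ps. holds M w (fst q) \<longleftrightarrow> holds M v (snd q))"
  by simp

declare sat.simps(3,4) [simp del]

lemma classical_sat_mono:
  assumes "classical \<Delta>" "\<forall>\<delta>\<in>\<Delta>. sat M T \<delta>" "S \<subseteq> T"
  shows "\<forall>\<delta>\<in>\<Delta>. sat M S \<delta>"
proof
  fix \<delta> assume \<delta>: "\<delta> \<in> \<Delta>"
  with assms(1,2) obtain \<alpha> where "\<delta> = emb \<alpha>" "sat M T (emb \<alpha>)" by blast
  then show "sat M S \<delta>" using assms(3) by auto
qed

lemma sat_empty: "sat M {} \<phi>"
proof (induction \<phi>)
  case (Dia \<phi>)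
  then show ?case by (auto simp: team_succ_def)
qed auto

lemma sat_Un:
  assumes "sat M T1 \<phi>" "sat M T2 \<phi>"
  shows "sat M (T1 \<union> T2) \<phi>"
  using assms
proof (induction \<phi> arbitrary: T1 T2)
  case (Or \<phi> \<psi>)
  from Or.prems obtain A1 B1 A2 B2 where
    "T1 = A1 \<union> B1" "sat M A1 \<phi>" "sat M B1 \<psi>" "T2 = A2 \<union> B2" "sat M A2 \<phi>" "sat M B2 \<psi>"
    by auto
  moreover from this have "sat M (A1 \<union> A2) \<phi>" "sat M (B1 \<union> B2) \<psi>" using Or.IH by blast+
  moreover from calculation have "T1 \<union> T2 = (A1 \<union> A2) \<union> (B1 \<union> B2)" by auto
  ultimately show ?case by (simp only: sat.simps(5)) blast
next
  case (Dia \<phi>)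
  from Dia.prems obtain S1 S2 where
    S: "team_succ M T1 S1" "sat M S1 \<phi>" "team_succ M T2 S2" "sat M S2 \<phi>" by auto
  then have "team_succ M (T1 \<union> T2) (S1 \<union> S2)" by (auto simp: team_succ_def)
  then show ?case using S Dia.IH by auto
next
  case (Inc ps)
  then show ?case by (simp, blast)
qed (auto simp: Image_Un)

section \<open>Inclusion atoms and iterated connectives\<close>

lemma holds_tv [simp]: "holds M w (tv x) = x"
  by (simp add: tv_def)

lemma holds_pow [simp]: "holds M w (pow \<alpha> x) \<longleftrightarrow> (holds M w \<alpha> \<longleftrightarrow> x)"
  by (simp add: pow_def)

lemma holds_big_cand: "holds M w (big_cand \<alpha>s) \<longleftrightarrow> (\<forall>\<alpha>\<in>set \<alpha>s. holds M w \<alpha>)"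
  by (induction \<alpha>s rule: induct_list012) auto

text \<open>The formula \<open>\<a>\<^sup>\<x>\<close> describes the list of truth values of \<open>\<a>\<close> completely; with this and
  \<open>sat_incl\<close>, reasoning about inclusion atoms becomes reasoning about lists of Booleans.\<close>

lemma holds_pows [simp]:
  assumes "length xs = length as"
  shows "holds M w (pows as xs) \<longleftrightarrow> map (holds M w) as = xs"
  unfolding pows_def holds_big_cand using assms
  by (induction xs as rule: list_induct2) auto

lemma sat_incl:
  assumes "length as = length bs"
  shows "sat M T (incl as bs) \<longleftrightarrow>
    (\<forall>w\<in>T. \<exists>v\<in>T. map (holds M w) as = map (holds M v) bs)"
proof -
  have "(\<forall>q\<in>set (zip as bs). holds M w (fst q) \<longleftrightarrow> holds M v (snd q)) \<longleftrightarrow>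
      map (holds M w) as = map (holds M v) bs" for w v
    using assms by (induction as bs rule: list_induct2) auto
  then show ?thesis by (simp add: incl_def)
qed

lemma sat_tincl:
  assumes "length xs = length as"
  shows "sat M T (tincl xs as) \<longleftrightarrow> T = {} \<or> (\<exists>v\<in>T. holds M v (pows as xs))"
  using assms by (auto simp: sat_incl comp_def)

lemma sat_CTop_incl:
  "sat M T (incl [CTop] [\<alpha>]) \<longleftrightarrow> T = {} \<or> (\<exists>v\<in>T. holds M v \<alpha>)"
  by (auto simp: sat_incl)

lemma sat_big_and: "sat M T (big_and \<phi>s) \<longleftrightarrow> (\<forall>\<phi>\<in>set \<phi>s. sat M T \<phi>)"
  by (induction \<phi>s rule: induct_list012) auto

lemma sat_big_or_enlarge:
  assumes "sat M S \<phi>"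
  shows "sat M (S \<union> {w\<in>U. \<exists>\<alpha>\<in>set \<alpha>s. holds M w \<alpha>}) (big_or (\<phi> # map emb \<alpha>s))"
  using assms
proof (induction \<alpha>s arbitrary: S \<phi>)
  case (Cons \<alpha> \<alpha>s)
  let ?A = "{w\<in>U. holds M w \<alpha>}"
  have "sat M (?A \<union> {w\<in>U. \<exists>\<alpha>\<in>set \<alpha>s. holds M w \<alpha>}) (big_or (emb \<alpha> # map emb \<alpha>s))"
    by (rule Cons.IH) simp
  moreover have "{w\<in>U. \<exists>\<beta>\<in>set (\<alpha> # \<alpha>s). holds M w \<beta>} =
      ?A \<union> {w\<in>U. \<exists>\<alpha>\<in>set \<alpha>s. holds M w \<alpha>}" by auto
  ultimately show ?case using Cons.prems by auto
qed simp

section \<open>Soundness of the rules\<close>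

text \<open>One half of the split team is empty or contains a witness for the atom. In the first case
  the other half is the whole team. In the second the witness itself is returned rather than the
  atom, because the rule for \<open>\<box>\<close> needs a world that sees it.\<close>

lemma sat_Or_tinclE:
  assumes "length xs = length as" "sat M T (Or (tincl xs as) \<psi>)"
  obtains v where "v \<in> T" "holds M v (pows as xs)" | "sat M T \<psi>"
proof -
  from assms(2) obtain T1 T2 where
    T: "T = T1 \<union> T2" "sat M T1 (tincl xs as)" "sat M T2 \<psi>" by auto
  from T(2) have "T1 = {} \<or> (\<exists>v\<in>T1. holds M v (pows as xs))" by (simp add: sat_tincl assms(1))
  then show ?thesis using T that by auto
qed

lemma sat_Dia_Or_distr:
  assumes "sat M T (Dia (Or \<phi> \<psi>))"
  shows "sat M T (Or (Dia \<phi>) (Dia \<psi>))"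
proof -
  from assms obtain S1 S2 where
    S: "team_succ M T (S1 \<union> S2)" "sat M S1 \<phi>" "sat M S2 \<psi>" by auto
  let ?T1 = "T \<inter> (rel M)\<inverse> `` S1" and ?T2 = "T \<inter> (rel M)\<inverse> `` S2"
  have "T = ?T1 \<union> ?T2" "team_succ M ?T1 S1" "team_succ M ?T2 S2"
    using S(1) unfolding team_succ_def by blast+
  then show ?thesis using S(2,3) by (simp only: sat.simps) blast
qed

lemma sat_incl_Cons:
  assumes "length bs = length cs" "sat M T (emb (pow \<alpha> x))" "sat M T (incl bs cs)"
  shows "sat M T (incl (tv x # bs) (\<alpha> # cs))"
  using assms by (auto simp: sat_incl)

text \<open>At a world of the team, the relevant instance of the premise is the one where the list \<open>\<x>\<close>
  consists of the truth values of \<open>\<a>\<close> at that world: there \<open>\<not>\<a>\<^sup>\<x>\<close> fails, so the world lies in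
  the half of the team that satisfies \<open>\<x> \<subseteq> \<b>\<close>.\<close>

lemma sat_incl_ext:
  assumes len: "length as = length bs"
    and sat: "sat M T (big_and (map (\<lambda>xs. Or (Neg (pows as xs)) (tincl xs bs))
          (List.n_lists (length as) [True, False])))"
  shows "sat M T (incl as bs)"
  unfolding sat_incl[OF len]
proof
  fix w assume w: "w \<in> T"
  let ?xs = "map (holds M w) as"
  have "?xs \<in> set (List.n_lists (length as) [True, False])"
    by (auto simp: set_n_lists)
  then have "sat M T (Or (Neg (pows as ?xs)) (tincl ?xs bs))"
    using sat unfolding sat_big_and set_map by blast
  then obtain T1 T2 where
    T: "T = T1 \<union> T2" "sat M T1 (Neg (pows as ?xs))" "sat M T2 (tincl ?xs bs)" by auto
  from T(2) have "w \<notin> T1" by auto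
  with T w have "w \<in> T2" by auto
  moreover have xs: "length ?xs = length bs" using len by simp
  ultimately obtain v where v: "v \<in> T2" "holds M v (pows bs ?xs)"
    using T(3) unfolding sat_tincl[OF xs] by blast
  from v(2) have "map (holds M v) bs = ?xs" unfolding holds_pows[OF xs] .
  with v(1) T(1) show "\<exists>v\<in>T. ?xs = map (holds M v) bs" by (metis UnI2)
qed

text \<open>The half of the team assigned to \<open>\<x> \<subseteq> \<b>\<close> is the whole team or empty, according to whether
  some world has \<open>\<x>\<close> as its list of truth values of \<open>\<a>\<close>. Taking just the worlds with that list
  would not do, as the witness for \<open>\<b>\<close> may lie elsewhere.\<close>

lemma sat_incl_reduct:
  assumes len: "length as = length bs" "length xs = length as" and sat: "sat M T (incl as bs)"
  shows "sat M T (Or (Neg (pows as xs)) (tincl xs bs))"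
proof (cases "\<exists>w\<in>T. holds M w (pows as xs)")
  case True
  then have "sat M T (tincl xs bs)" using sat len by (auto simp: sat_incl comp_def)
  then show ?thesis using sat_empty[of M "Neg (pows as xs)"]
    by (simp only: sat.simps(5)) blast
next
  case False
  then have "sat M T (Neg (pows as xs))" by auto
  then show ?thesis using sat_empty[of M "tincl xs bs"]
    by (simp only: sat.simps(5)) blast
qed

text \<open>The half satisfying \<open>\<phi>\<close> may miss the witnesses of the given atoms, so it is enlarged by all
  worlds of \<open>T\<close> where some \<open>\<a>\<^sup>\<x>\<close> holds; the halves of a split may overlap, so the other half
  stays as it is.\<close>

lemma sat_incl_distr:
  assumes or: "sat M T (Or \<phi> \<psi>)"
    and len: "\<And>xs as. (xs, as) \<in> set ps \<Longrightarrow> length xs = length as"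
    and inc: "\<And>xs as. (xs, as) \<in> set ps \<Longrightarrow> sat M T (tincl xs as)"
  shows "sat M T (Or (big_and (big_or (\<phi> # map (\<lambda>(xs, as). emb (pows as xs)) ps) #
               map (\<lambda>(xs, as). tincl xs as) ps)) \<psi>)"
proof -
  from or obtain T1 T2 where T: "T = T1 \<union> T2" "sat M T1 \<phi>" "sat M T2 \<psi>" by auto
  let ?\<alpha>s = "map (\<lambda>(xs, as). pows as xs) ps"
  let ?U = "T1 \<union> {w\<in>T. \<exists>\<alpha>\<in>set ?\<alpha>s. holds M w \<alpha>}"
  have eq: "map (\<lambda>(xs, as). emb (pows as xs)) ps = map emb ?\<alpha>s" by auto
  have "sat M ?U (big_or (\<phi> # map (\<lambda>(xs, as). emb (pows as xs)) ps))"
    unfolding eq using T(2) by (rule sat_big_or_enlarge)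
  moreover have "sat M ?U (tincl xs as)" if "(xs, as) \<in> set ps" for xs as
  proof -
    from inc[OF that] len[OF that] have "T = {} \<or> (\<exists>v\<in>T. holds M v (pows as xs))"
      by (simp only: sat_tincl)
    then have "?U = {} \<or> (\<exists>v\<in>?U. holds M v (pows as xs))" using T(1) that by force
    then show ?thesis using len[OF that] by (simp only: sat_tincl)
  qed
  ultimately have "sat M ?U (big_and (big_or (\<phi> # map (\<lambda>(xs, as). emb (pows as xs)) ps) #
               map (\<lambda>(xs, as). tincl xs as) ps))"
    unfolding sat_big_and by auto
  moreover have "T = ?U \<union> T2" using T(1) by auto
  ultimately show ?thesis using T(3) by (simp only: sat.simps(5)) blast
qed

text \<open>Enlarging the successor team by worlds of \<open>R[T]\<close> keeps it a successor team. It then contains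
  a witness for each \<open>\<alpha>\<^sup>x\<close>: if \<open>x\<close> is \<open>\<top>\<close>, some world of \<open>T\<close> sees one. If \<open>x\<close> is \<open>\<bottom>\<close>, some world
  of \<open>T\<close> sees no world satisfying \<open>\<alpha>\<close>, and the successor that it has in the original team serves.\<close>

lemma sat_incl_Dia_distr:
  assumes dia: "sat M T (Dia \<phi>)"
    and inc: "\<And>x \<alpha>. (x, \<alpha>) \<in> set ps \<Longrightarrow> sat M T (tincl [x] [CDia \<alpha>])"
  shows "sat M T (Dia (big_and (big_or (\<phi> # map (\<lambda>(x, \<alpha>). emb (pow \<alpha> x)) ps) #
                map (\<lambda>(x, \<alpha>). tincl [x] [\<alpha>]) ps)))"
proof -
  from dia obtain S where S: "team_succ M T S" "sat M S \<phi>" by auto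
  let ?\<alpha>s = "map (\<lambda>(x, \<alpha>). pow \<alpha> x) ps"
  let ?U = "S \<union> {w \<in> rel M `` T. \<exists>\<alpha>\<in>set ?\<alpha>s. holds M w \<alpha>}"
  have eq: "map (\<lambda>(x, \<alpha>). emb (pow \<alpha> x)) ps = map emb ?\<alpha>s" by auto
  have "sat M ?U (big_or (\<phi> # map (\<lambda>(x, \<alpha>). emb (pow \<alpha> x)) ps))"
    unfolding eq using S(2) by (rule sat_big_or_enlarge)
  moreover have "sat M ?U (tincl [x] [\<alpha>])" if ps: "(x, \<alpha>) \<in> set ps" for x \<alpha>
  proof (cases "T = {}")
    case True
    then have "?U = {}" using S(1) by (auto simp: team_succ_def)
    then show ?thesis by (simp only: sat_empty)
  next
    case False
    with inc[OF ps] obtain w where w: "w \<in> T" "holds M w (CDia \<alpha>) \<longleftrightarrow> x"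
      by (auto simp: sat_incl)
    from S(1) w(1) obtain u where "u \<in> S" "(w, u) \<in> rel M" by (auto simp: team_succ_def)
    then obtain v where v: "(w, v) \<in> rel M" "holds M v (pow \<alpha> x)"
      using w(2) by (cases x) auto
    have "v \<in> ?U" using v w(1) ps by force
    moreover have "holds M v (pows [\<alpha>] [x])" using v(2) by simp
    ultimately have "?U = {} \<or> (\<exists>v\<in>?U. holds M v (pows [\<alpha>] [x]))" by blast
    moreover have len: "length [x] = length [\<alpha>]" by simp
    ultimately show ?thesis unfolding sat_tincl[OF len] by blast
  qed
  ultimately have "sat M ?U (big_and (big_or (\<phi> # map (\<lambda>(x, \<alpha>). emb (pow \<alpha> x)) ps) #
                map (\<lambda>(x, \<alpha>). tincl [x] [\<alpha>]) ps))"
    unfolding sat_big_and by auto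
  moreover have "team_succ M T ?U" using S(1) by (auto simp: team_succ_def)
  ultimately show ?thesis by (simp only: sat.simps(7)) blast
qed

text \<open>The team has to vary in the induction because \<open>BoxMon\<close> and \<open>DiaMon\<close> apply the hypothesis to
  successor teams, and \<open>NegI\<close>, \<open>RAA\<close> and \<open>OrE\<close> apply it to subteams.\<close>

lemma derives_sat:
  assumes "\<Gamma> \<turnstile> \<phi>" "\<forall>\<gamma>\<in>\<Gamma>. sat M T \<gamma>"
  shows "sat M T \<phi>"
  using assms
proof (induction arbitrary: T rule: derives.induct)
  case (NegI \<Delta> \<Gamma> \<alpha>)
  have "\<not> holds M w \<alpha>" if "w \<in> T" for w
  proof
    assume "holds M w \<alpha>"
    moreover have "\<forall>\<delta>\<in>\<Delta>. sat M {w} \<delta>"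
      using classical_sat_mono[OF NegI.hyps(1), of M T "{w}"] NegI.hyps(2) NegI.prems that by auto
    ultimately have "sat M {w} Bot" by (intro NegI.IH) auto
    then show False by simp
  qed
  then show ?case by simp
next
  case (RAA \<Delta> \<Gamma> \<alpha>)
  have "holds M w \<alpha>" if "w \<in> T" for w
  proof (rule ccontr)
    assume "\<not> holds M w \<alpha>"
    moreover have "\<forall>\<delta>\<in>\<Delta>. sat M {w} \<delta>"
      using classical_sat_mono[OF RAA.hyps(1), of M T "{w}"] RAA.hyps(2) RAA.prems that by auto
    ultimately have "sat M {w} Bot" by (intro RAA.IH) auto
    then show False by simp
  qed
  then show ?case by simp
next
  case (NegE \<Gamma> \<alpha> \<phi>)
  then have "\<forall>w\<in>T. holds M w \<alpha>" "\<forall>w\<in>T. \<not> holds M w \<alpha>" by fastforce+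
  then have "T = {}" by auto
  then show ?case by (simp add: sat_empty)
next
  case (OrI1 \<Gamma> \<phi> \<psi>)
  then have "sat M T \<phi>" by blast
  then show ?case using sat_empty[of M \<psi>] by (simp only: sat.simps) blast
next
  case (OrI2 \<Gamma> \<psi> \<phi>)
  then have "sat M T \<psi>" by blast
  then show ?case using sat_empty[of M \<phi>] by (simp only: sat.simps) blast
next
  case (OrE \<Delta> \<Gamma> \<phi> \<psi> \<chi>)
  then have "sat M T (Or \<phi> \<psi>)" by blast
  then obtain T1 T2 where T: "T = T1 \<union> T2" "sat M T1 \<phi>" "sat M T2 \<psi>" by auto
  have \<Delta>: "\<forall>\<delta>\<in>\<Delta>. sat M S \<delta>" if "S \<subseteq> T" for S
    using classical_sat_mono[OF OrE.hyps(1) _ that] OrE.hyps(2) OrE.prems by blast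
  have "sat M T1 \<chi>" by (rule OrE.IH(2)) (use \<Delta>[of T1] T in auto)
  moreover have "sat M T2 \<chi>" by (rule OrE.IH(3)) (use \<Delta>[of T2] T in auto)
  ultimately show ?case unfolding T(1) by (rule sat_Un)
next
  case (DiaBoxInter \<Gamma> \<alpha>)
  then have "sat M T (Neg (CBox \<alpha>))" by blast
  then have "sat M T (emb (CDia (CNeg \<alpha>)))" unfolding sat_emb by auto
  then show ?case by (simp only: emb.simps)
next
  case (BoxDiaInter \<Gamma> \<alpha>)
  then have "sat M T (emb (CDia (CNeg \<alpha>)))" by (simp only: emb.simps)
  then show ?case unfolding sat_emb by auto
next
  case (DiaOrDistr \<Gamma> \<phi> \<psi>)
  then show ?case by (blast intro: sat_Dia_Or_distr)
next
  case (BoxMon \<phi>s \<psi> \<Gamma>)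
  have "sat M (rel M `` T) \<psi>"
    by (rule BoxMon.IH(1)) (use BoxMon.IH(2) BoxMon.prems in auto)
  then show ?case by simp
next
  case (DiaMon \<phi> \<psi> \<Gamma>)
  then have "sat M T (Dia \<phi>)" by blast
  then obtain S where "team_succ M T S" "sat M S \<phi>" by auto
  moreover from this have "sat M S \<psi>" by (intro DiaMon.IH(1)) auto
  ultimately show ?case by auto
next
  case (IncId \<Gamma> as)
  then show ?case by (auto simp: sat_incl)
next
  case (IncExp bs cs \<Gamma> \<alpha> x)
  then show ?case by (blast intro: sat_incl_Cons)
next
  case (IncNegE xs as \<Gamma> \<phi>)
  then have "sat M T (Neg (pows as xs))" "sat M T (tincl xs as)" by blast+
  then have "T = {}" using IncNegE.hyps(1) unfolding sat_tincl[OF IncNegE.hyps(1)] by auto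
  then show ?case by (simp add: sat_empty)
next
  case (OrIncE xs as \<Gamma> \<psi> \<chi>)
  then have "sat M T (Or (tincl xs as) \<psi>)" by blast
  with OrIncE.hyps(1) show ?case
  proof (cases rule: sat_Or_tinclE)
    case (1 v)
    then have "sat M T (tincl xs as)" unfolding sat_tincl[OF OrIncE.hyps(1)] by blast
    then show ?thesis using OrIncE.IH(2) OrIncE.prems by blast
  next
    case 2
    then show ?thesis using OrIncE.IH(3) OrIncE.prems by blast
  qed
next
  case (IncExt as bs \<Gamma>)
  then show ?case by (blast intro: sat_incl_ext)
next
  case (IncRdt as bs xs \<Gamma>)
  then show ?case by (blast intro: sat_incl_reduct)
next
  case (IncDistr \<Gamma> \<phi> \<psi> ps)
  show ?case by (rule sat_incl_distr) (use IncDistr in blast)+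
next
  case (DiaIncDistr xs as \<Gamma>)
  then have "sat M T (Dia (tincl xs as))" by blast
  then obtain S where S: "team_succ M T S" "sat M S (tincl xs as)" unfolding sat.simps(7) by blast
  from S(2) have "S = {} \<or> (\<exists>v\<in>S. holds M v (pows as xs))"
    unfolding sat_tincl[OF DiaIncDistr.hyps(1)] .
  then have "T = {} \<or> (\<exists>w\<in>T. holds M w (CDia (pows as xs)))"
    using S(1) unfolding team_succ_def holds.simps by blast
  then show ?case by (simp only: sat_CTop_incl)
next
  case (DiaBoxIncExc xs as \<Gamma>)
  then have "sat M T (incl [CTop] [CDia (pows as xs)])" by blast
  then have "T = {} \<or> (\<exists>w\<in>T. holds M w (CDia (pows as xs)))"
    unfolding sat_CTop_incl .
  then have "rel M `` T = {} \<or> (\<exists>v\<in>rel M `` T. holds M v (pows as xs))"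
    unfolding holds.simps by blast
  then show ?case unfolding sat.simps(8) sat_tincl[OF DiaBoxIncExc.hyps(1)] .
next
  case (BoxDiaIncExc xs as \<Gamma> \<beta>)
  then have "sat M T (incl [CTop] [CDia \<beta>])" by blast
  then have "T = {} \<or> (\<exists>w\<in>T. holds M w (CDia \<beta>))" unfolding sat_CTop_incl .
  moreover have "sat M T (Box (tincl xs as))" using BoxDiaIncExc by blast
  then have "rel M `` T = {} \<or> (\<exists>v\<in>rel M `` T. holds M v (pows as xs))"
    unfolding sat.simps(8) sat_tincl[OF BoxDiaIncExc.hyps(1)] .
  ultimately have "T = {} \<or> (\<exists>w\<in>T. holds M w (CDia (pows as xs)))"
    unfolding holds.simps by blast
  then show ?case by (simp only: sat_CTop_incl)
next
  case (BoxOrIncE xs as \<Gamma> \<psi> \<chi>)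
  then have "sat M T (Box (Or (tincl xs as) \<psi>))" by blast
  then have "sat M (rel M `` T) (Or (tincl xs as) \<psi>)" unfolding sat.simps(8) .
  with BoxOrIncE.hyps(1) show ?case
  proof (cases rule: sat_Or_tinclE)
    case (1 v)
    then have "\<exists>w\<in>T. holds M w (CDia (pows as xs))" unfolding holds.simps by blast
    then have "sat M T (incl [CTop] [CDia (pows as xs)])" unfolding sat_CTop_incl by blast
    then show ?thesis using BoxOrIncE.IH(2) BoxOrIncE.prems by blast
  next
    case 2
    then have "sat M T (Box \<psi>)" by simp
    then show ?thesis using BoxOrIncE.IH(3) BoxOrIncE.prems by blast
  qed
next
  case (IncDiaDistr \<Gamma> \<phi> ps)
  show ?case by (rule sat_incl_Dia_distr) (use IncDiaDistr in blast)+
qed auto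

theorem theorem4p2:
  fixes \<Gamma> :: "'p::{countable, infinite} mlinc set" and \<phi> :: "'p mlinc"
  assumes "\<Gamma> \<turnstile> \<phi>"
  shows "entails TYPE('w) \<Gamma> \<phi>"
  using derives_sat[OF assms] unfolding entails_def by blast

end
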